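(* The central Binomiacci numbers $\mathcal{B}_{n,n}$ satisfy, as $n\to\infty$, $$\mathcal{B}_{n,n} = \frac{3 \cdot 4^n}{\sqrt{\pi n}} + o\left( \frac{4^n}{\sqrt{n}} \right).$$
   Context: $\langle \mathcal{F}_j \rangle_{j\ge 0} = \langle 1,1,2,3,5,8,13,\ldots\rangle$ is the Fibonacci sequence indexed so that $\mathcal{F}_0=\mathcal{F}_1=1$ and $\mathcal{F}_{j+2}=\mathcal{F}_{j+1}+\mathcal{F}_j$. The Binomiacci numbers $\langle \mathcal{B}_{k,n}\rangle_{k,n\ge 0}$ are defined by $\mathcal{B}_{0,n}=\mathcal{F}_n$ for $n\ge 0$, $\mathcal{B}_{k,0}=\mathcal{F}_k$ for $k\ge 0$, and $\mathcal{B}_{k,n}=\mathcal{B}_{k,n-1}+\mathcal{B}_{k-1,n}$ for $k,n\ge 1$. *)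

theory Defs
  imports Complex_Main "HOL-Library.Landau_Symbols" "HOL-Number_Theory.Fib"
begin

(* The library sequence fib starts at fib 0 = 0, fib 1 = 1; here the indexing is F_0 = F_1 = 1. *)
definition fibonacci :: "nat \<Rightarrow> nat" where
  "fibonacci j = fib (Suc j)"

(* The two boundary equations overlap at (0, 0), where they agree. *)
fun binomiacci :: "nat \<Rightarrow> nat \<Rightarrow> nat" where
  "binomiacci 0 n = fibonacci n"
| "binomiacci k 0 = fibonacci k"
| "binomiacci (Suc k) (Suc n) = binomiacci (Suc k) n + binomiacci k (Suc n)"

lemma fibonacci_rec:
  "fibonacci 0 = 1" "fibonacci (Suc 0) = 1"
  "fibonacci (Suc (Suc j)) = fibonacci (Suc j) + fibonacci j"
  by (simp_all add: fibonacci_def)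

lemma binomiacci_n_0: "binomiacci k 0 = fibonacci k"
  by (cases k) simp_all

end

theory Submission
  imports Defs "HOL-Analysis.Gamma_Function" "HOL-Real_Asymp.Real_Asymp"
begin

text \<open>
  Away from the boundary the array obeys Pascal's rule, so it is a superposition of binomial
  arrays issuing from the two Fibonacci boundaries. On the diagonal this reads
  \<open>B(n,n) = C(2n,n) + 2 (\<Sum>i<n. fib i C(2n-1-i,n))\<close>. Divided by \<open>C(2n,n)\<close>, the \<open>i\<close>-th binomial
  coefficient is at most \<open>2^-(i+1)\<close> and converges to it, so by Tannery's theorem the quotient
  converges to \<open>1 + 2 (\<Sum>i. fib i / 2^(i+1)) = 3\<close>. The asymptotics of \<open>C(2n,n) = (-4)^n (-1/2 gchoose n)\<close>
  come from Euler's limit for the Gamma function.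
\<close>

text \<open>For \<open>n > 0\<close> this is the coefficient of x^(n-1) in x / (1 - x - x^2) * (1 -
  x)^-(k+1), the contribution of one Fibonacci boundary. As \<open>i < n\<close>, the subtraction
  never truncates.\<close>

definition fib_conv :: "nat \<Rightarrow> nat \<Rightarrow> nat" where
  "fib_conv k n = (\<Sum>i<n. fib i * ((k + n - 1 - i) choose k))"

lemma fib_conv_0_right [simp]: "fib_conv k 0 = 0"
  by (simp add: fib_conv_def)

text \<open>For \<open>k = 0\<close> all the binomials are 1, so this is the classical formula for
  partial sums of Fibonacci numbers. It matches the boundary values of the array.\<close>

lemma Suc_fib_conv_0_left: "Suc (fib_conv 0 n) = fib (Suc n)"
  by (induction n) (auto simp: fib_conv_def)

lemma fib_conv_Suc_Suc:
  "fib_conv (Suc k) (Suc n) = fib_conv (Suc k) n + fib_conv k (Suc n)"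
proof -
  have "fib_conv (Suc k) (Suc n)
      = (\<Sum>i<Suc n. fib i * ((k + n - i) choose Suc k) + fib i * ((k + n - i) choose k))"
    unfolding fib_conv_def
    by (intro sum.cong) (auto simp: Suc_diff_le algebra_simps)
  also have "\<dots> = (\<Sum>i<Suc n. fib i * ((k + n - i) choose Suc k)) + fib_conv k (Suc n)"
    by (simp only: sum.distrib fib_conv_def) simp
  \<comment> \<open>The top summand \<open>i = n\<close> contains \<open>k choose Suc k = 0\<close>
    and drops out.\<close>
  also have "(\<Sum>i<Suc n. fib i * ((k + n - i) choose Suc k)) = fib_conv (Suc k) n"
    by (simp add: fib_conv_def)
  finally show ?thesis .
qed

text \<open>All three summands obey the recurrence of the array, so only the boundaries need
  checking. There the binomial supplies the 1 missing from the Fibonacci partial sum.\<close>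

lemma binomiacci_eq: "binomiacci k n = ((k + n) choose n) + fib_conv k n + fib_conv n k"
proof (induction k n rule: binomiacci.induct)
  case (1 n)
  then show ?case using Suc_fib_conv_0_left[of n] by (simp add: fibonacci_def)
next
  case (2 k)
  then show ?case using Suc_fib_conv_0_left[of "Suc k"] by (simp add: fibonacci_def)
next
  case (3 k n)
  then show ?case by (simp add: fib_conv_Suc_Suc)
qed

text \<open>For \<open>n > 0\<close> this is 0 as soon as \<open>j > n\<close>, even where the
  subtraction truncates. At \<open>n = 0\<close> it is 1 for every \<open>j\<close>, so the
  geometric bound below needs \<open>n > 0\<close>.\<close>

definition shifted_ratio :: "nat \<Rightarrow> nat \<Rightarrow> real" where
  "shifted_ratio j n = real ((2 * n - j) choose n) / real ((2 * n) choose n)"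

lemma shifted_ratio_0 [simp]: "shifted_ratio 0 n = 1"
  by (simp add: shifted_ratio_def)

lemma shifted_ratio_nonneg: "shifted_ratio j n \<ge> 0"
  by (simp add: shifted_ratio_def)

lemma shifted_ratio_Suc:
  assumes "n > 0"
  shows "shifted_ratio (Suc j) n = shifted_ratio j n * (real (n - j) / real (2 * n - j))"
proof (cases "2 * n - j = 0")
  \<comment> \<open>Both sides vanish: \<open>0 choose n = 0\<close> on the left, division by zero
    on the right.\<close>
  case True
  then have "2 * n - Suc j = 0" by simp
  then show ?thesis using True assms by (simp add: shifted_ratio_def)
next
  case False
  have "(2 * n - j - n) * ((2 * n - j) choose n) = (2 * n - j) * ((2 * n - j - 1) choose n)"
    by (rule binomial_absorb_comp)
  moreover have "2 * n - j - n = n - j" "2 * n - j - 1 = 2 * n - Suc j"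
    by simp_all
  ultimately have "real (n - j) * real ((2 * n - j) choose n)
      = real (2 * n - j) * real ((2 * n - Suc j) choose n)"
    by (metis of_nat_mult)
  then show ?thesis using False
    by (simp add: shifted_ratio_def field_simps del: of_nat_diff)
qed

text \<open>Every factor in \<open>shifted_ratio_Suc\<close> is at most 1/2, since 2(n - j) <= 2n -
  j also under truncated subtraction.\<close>

lemma shifted_ratio_le: "n > 0 \<Longrightarrow> shifted_ratio j n \<le> (1/2) ^ j"
proof (induction j)
  case (Suc j)
  have "2 * real (n - j) \<le> real (2 * n - j)"
    by (metis (no_types) diff_le_mono2 diff_mult_distrib2 le_add1 mult_2 of_nat_le_iff of_nat_mult of_nat_numeral)
  then have "real (n - j) / real (2 * n - j) \<le> 1/2"
    by (cases "2 * n - j = 0") (auto simp: divide_simps simp del: of_nat_diff)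
  with Suc have "shifted_ratio j n * (real (n - j) / real (2 * n - j)) \<le> (1/2) ^ j * (1/2)"
    by (intro mult_mono) auto
  with Suc.prems show ?case by (simp add: shifted_ratio_Suc)
qed simp

lemma shifted_ratio_tendsto: "shifted_ratio j \<longlonglongrightarrow> (1/2) ^ j"
proof (induction j)
  case 0
  then show ?case by (simp add: shifted_ratio_def)
next
  case (Suc j)
  have "(\<lambda>n. (real n - real j) / (2 * real n - real j)) \<longlonglongrightarrow> 1/2"
    by real_asymp
  moreover have "\<forall>\<^sub>F n in sequentially.
      (real n - real j) / (2 * real n - real j) = real (n - j) / real (2 * n - j)"
    using eventually_ge_at_top[of j] by eventually_elim (simp add: of_nat_diff)
  ultimately have "(\<lambda>n. real (n - j) / real (2 * n - j)) \<longlonglongrightarrow> 1/2"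
    by (rule Lim_transform_eventually)
  with Suc have "(\<lambda>n. shifted_ratio j n * (real (n - j) / real (2 * n - j))) \<longlonglongrightarrow> (1/2) ^ j * (1/2)"
    by (rule tendsto_mult)
  moreover have "\<forall>\<^sub>F n in sequentially.
      shifted_ratio j n * (real (n - j) / real (2 * n - j)) = shifted_ratio (Suc j) n"
    using eventually_gt_at_top[of 0] by eventually_elim (simp add: shifted_ratio_Suc)
  ultimately have "shifted_ratio (Suc j) \<longlonglongrightarrow> (1/2) ^ j * (1/2)"
    by (rule Lim_transform_eventually)
  then show ?case by simp
qed

text \<open>The base 7/4 satisfies x + 1 <= x^2, which drives the induction, and lies below 2, which
  makes \<open>fib n / 2 ^ n\<close> tend to 0.\<close>

lemma fib_le_power: "real (fib n) \<le> (7/4) ^ n"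
proof (induction n rule: fib.induct)
  case (3 n)
  have "real (fib (Suc (Suc n))) \<le> (7/4) ^ Suc n + (7/4) ^ n"
    using "3.IH" by simp
  also have "\<dots> = 11/4 * (7/4) ^ n"
    by simp
  also have "\<dots> \<le> (7/4)\<^sup>2 * (7/4) ^ n"
    by (intro mult_right_mono) (simp_all add: power2_eq_square)
  also have "\<dots> = (7/4) ^ Suc (Suc n)"
    by (simp add: power2_eq_square)
  finally show ?case .
qed simp_all

lemma sums_fib_half_powers: "(\<lambda>i. real (fib i) * (1/2) ^ Suc i) sums 1"
proof -
  \<comment> \<open>The sum telescopes, because 2 fib(n+2) - fib(n+3) = fib n.\<close>
  have partial: "(\<Sum>i<n. real (fib i) * (1/2) ^ Suc i) = 1 - real (fib (n + 2)) / 2 ^ n" for n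
    by (induction n) (auto simp: field_simps)
  have "(\<lambda>n. real (fib (n + 2)) / 2 ^ n) \<longlonglongrightarrow> 0"
  proof (rule Lim_null_comparison)
    show "\<forall>\<^sub>F n in sequentially. norm (real (fib (n + 2)) / 2 ^ n) \<le> (7/4)\<^sup>2 * (7/8) ^ n"
    proof (intro always_eventually allI)
      fix n
      have "real (fib (n + 2)) / 2 ^ n \<le> (7/4) ^ (n + 2) / 2 ^ n"
        by (intro divide_right_mono fib_le_power) simp
      also have "\<dots> = (7/4)\<^sup>2 * ((7/4) / 2) ^ n"
        by (simp only: power_divide power_add) simp
      finally show "norm (real (fib (n + 2)) / 2 ^ n) \<le> (7/4)\<^sup>2 * (7/8) ^ n"
        by simp
    qed
    show "(\<lambda>n. (7/4)\<^sup>2 * (7/8) ^ n :: real) \<longlonglongrightarrow> 0"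
      by real_asymp
  qed
  from tendsto_diff[OF tendsto_const[of 1] this] show ?thesis
    unfolding sums_def partial by simp
qed

lemma fib_conv_ratio_tendsto:
  "(\<lambda>n. real (fib_conv n n) / real ((2 * n) choose n)) \<longlonglongrightarrow> 1"
proof -
  define a where "a = (\<lambda>i n. real (fib i) * shifted_ratio (Suc i) n)"
  have "(\<lambda>n. \<Sum>i. a i n) \<longlonglongrightarrow> (\<Sum>i. real (fib i) * (1/2) ^ Suc i)"
  proof (rule tannerys_theorem[THEN conjunct2, THEN conjunct2])
    show "a i \<longlonglongrightarrow> real (fib i) * (1/2) ^ Suc i" for i
      unfolding a_def by (intro tendsto_mult tendsto_const shifted_ratio_tendsto)
    show "summable (\<lambda>i. real (fib i) * (1/2) ^ Suc i)"
      using sums_fib_half_powers by (rule sums_summable)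
    \<comment> \<open>Tannery's theorem asks for domination eventually in the pair
      \<open>(i, n)\<close>; here it holds for all \<open>i\<close> once
      \<open>n > 0\<close>.\<close>
    have "\<forall>\<^sub>F x in at_top \<times>\<^sub>F sequentially. 0 < (snd x :: nat)"
      by (intro eventually_compose_filterlim[OF eventually_gt_at_top filterlim_snd])
    then show "\<forall>\<^sub>F (i, n) in at_top \<times>\<^sub>F sequentially.
        norm (a i n) \<le> real (fib i) * (1/2) ^ Suc i"
    proof eventually_elim
      case (elim x)
      show ?case
        using shifted_ratio_le[OF elim, of "Suc (fst x)"]
        by (auto simp: a_def abs_mult shifted_ratio_nonneg case_prod_beta simp del: power_Suc
                 intro!: mult_left_mono)
    qed
  qed simp
  also have "(\<Sum>i. real (fib i) * (1/2) ^ Suc i) = 1"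
    using sums_fib_half_powers by (simp add: sums_iff)
  finally have "(\<lambda>n. \<Sum>i. a i n) \<longlonglongrightarrow> 1" .
  moreover have "\<forall>\<^sub>F n in sequentially.
      (\<Sum>i. a i n) = real (fib_conv n n) / real ((2 * n) choose n)"
    using eventually_gt_at_top[of 0]
  proof eventually_elim
    case (elim n)
    \<comment> \<open>For \<open>i >= n\<close> the upper index \<open>2 * n - Suc i\<close> is
      below \<open>n\<close>, so the binomial is 0.\<close>
    have "(\<Sum>i. a i n) = (\<Sum>i<n. a i n)"
      using elim by (intro suminf_finite) (auto simp: a_def shifted_ratio_def)
    also have "\<dots> = real (fib_conv n n) / real ((2 * n) choose n)"
      by (simp add: a_def shifted_ratio_def fib_conv_def sum_divide_distrib flip: mult_2)
    finally show ?case .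
  qed
  ultimately show ?thesis by (rule Lim_transform_eventually)
qed

text \<open>Passing from n to n + 1 multiplies both sides by -(2n+1) / (2(n+1)).\<close>

lemma gbinomial_minus_half:
  "(-1/2 :: real) gchoose n = (-1) ^ n * real ((2 * n) choose n) / 4 ^ n"
proof (induction n)
  case (Suc n)
  have 1: "real (Suc n) * ((-1/2 :: real) gchoose Suc n) = (-1/2 - real n) * (-1/2 gchoose n)"
    using gbinomial_mult_1[of "-1/2 :: real" n] by (simp add: algebra_simps)
  have "Suc n * ((2 * Suc n) choose Suc n) = 2 * Suc n * (Suc (2 * n) choose n)"
    using Suc_times_binomial[of n "Suc (2 * n)"] by simp
  then have "((2 * Suc n) choose Suc n) = 2 * (Suc (2 * n) choose n)"
    by (simp only: mult.assoc mult.left_commute[of 2 "Suc n"] mult_cancel1) simp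
  moreover have "Suc n * (Suc (2 * n) choose n) = Suc (2 * n) * ((2 * n) choose n)"
    using binomial_absorb_comp[of "Suc (2 * n)" n] by (simp add: Suc_diff_le)
  ultimately have "Suc n * ((2 * Suc n) choose Suc n) = 2 * (Suc (2 * n) * ((2 * n) choose n))"
    by (simp only: mult.left_commute[of "Suc n" 2])
  then have "real (Suc n * ((2 * Suc n) choose Suc n))
      = real (2 * (Suc (2 * n) * ((2 * n) choose n)))"
    by (rule arg_cong)
  then have 2: "real (Suc n) * real ((2 * Suc n) choose Suc n)
      = 2 * (real (Suc (2 * n)) * real ((2 * n) choose n))"
    by (simp only: of_nat_mult of_nat_numeral)
  have "real (Suc n) * ((-1/2 :: real) gchoose Suc n)
      = (-1) ^ Suc n * (2 * (real (Suc (2 * n)) * real ((2 * n) choose n))) / 4 ^ Suc n"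
    unfolding 1 Suc.IH by (simp add: divide_simps) (simp add: algebra_simps)
  also have "\<dots> = real (Suc n) * ((-1) ^ Suc n * real ((2 * Suc n) choose Suc n) / 4 ^ Suc n)"
    by (simp only: 2[symmetric] mult.left_commute times_divide_eq_right)
  finally show ?case
    by (simp only: mult_cancel_left of_nat_eq_0_iff nat.simps simp_thms)
qed simp

text \<open>The general asymptotics of \<open>z gchoose n\<close> at z = -1/2, where Gamma(1/2) =
  sqrt(pi) and n^(z+1) = sqrt(n); the signs cancel.\<close>

lemma central_binomial_tendsto:
  "(\<lambda>n. sqrt (real n) * real ((2 * n) choose n) / 4 ^ n) \<longlonglongrightarrow> 1 / sqrt pi"
proof -
  have "(\<lambda>n. (-1/2 gchoose n) / ((-1) ^ n / exp ((-1/2 + 1) * of_real (ln (real n)))))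
      \<longlonglongrightarrow> inverse (Gamma (- (-1/2 :: real)))"
    by (rule gbinomial_asymptotic)
  then have "(\<lambda>n. (-1/2 gchoose n) / ((-1) ^ n / exp ((-1/2 + 1) * of_real (ln (real n)))))
      \<longlonglongrightarrow> 1 / sqrt pi"
    by (simp add: Gamma_one_half_real inverse_eq_divide)
  moreover have "\<forall>\<^sub>F n in sequentially.
      (-1/2 gchoose n) / ((-1) ^ n / exp ((-1/2 + 1) * of_real (ln (real n))))
      = sqrt (real n) * real ((2 * n) choose n) / 4 ^ n"
    using eventually_gt_at_top[of 0]
  proof eventually_elim
    case (elim n)
    then have "exp ((-1/2 + 1) * of_real (ln (real n))) = sqrt (real n)"
      by (simp add: powr_def flip: powr_half_sqrt)
    then show ?case by (simp only: gbinomial_minus_half) simp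
  qed
  ultimately show ?thesis by (rule Lim_transform_eventually)
qed

theorem corollary3p2:
  shows "(\<lambda>n::nat. real (binomiacci n n) - 3 * 4 ^ n / sqrt (pi * real n))
           \<in> o(\<lambda>n. 4 ^ n / sqrt (real n))"
proof (rule smalloI_tendsto)
  \<comment> \<open>The error divided by \<open>4 ^ n / sqrt n\<close>, with C(2n,n) factored out of
    \<open>binomiacci n n\<close> so that both known limits apply.\<close>
  have "(\<lambda>n. sqrt (real n) * real ((2 * n) choose n) / 4 ^ n
          * (1 + 2 * (real (fib_conv n n) / real ((2 * n) choose n))) - 3 / sqrt pi)
      \<longlonglongrightarrow> 1 / sqrt pi * (1 + 2 * 1) - 3 / sqrt pi"
    by (intro tendsto_intros central_binomial_tendsto fib_conv_ratio_tendsto)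
  then have "(\<lambda>n. sqrt (real n) * real ((2 * n) choose n) / 4 ^ n
          * (1 + 2 * (real (fib_conv n n) / real ((2 * n) choose n))) - 3 / sqrt pi) \<longlonglongrightarrow> 0"
    by simp
  moreover have "\<forall>\<^sub>F n in sequentially.
      sqrt (real n) * real ((2 * n) choose n) / 4 ^ n
          * (1 + 2 * (real (fib_conv n n) / real ((2 * n) choose n))) - 3 / sqrt pi
      = (real (binomiacci n n) - 3 * 4 ^ n / sqrt (pi * real n)) / (4 ^ n / sqrt (real n))"
    using eventually_gt_at_top[of 0]
  proof eventually_elim
    case (elim n)
    define c where "c = real ((2 * n) choose n)"
    define f where "f = real (fib_conv n n)"
    define s where "s = sqrt (real n)"
    define p where "p = (4 :: real) ^ n"
    have pos: "c > 0" "s > 0" "p > 0"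
      using elim by (simp_all add: c_def s_def p_def)
    have B: "real (binomiacci n n) = c + 2 * f"
      by (simp add: binomiacci_eq c_def f_def flip: mult_2)
    have "s * c / p * (1 + 2 * (f / c)) = s * (c + 2 * f) / p"
      using pos by (simp add: divide_simps)
    moreover have "(c + 2 * f - 3 * p / (sqrt pi * s)) / (p / s) = s * (c + 2 * f) / p - 3 / sqrt pi"
      using pos by (simp add: field_simps)
    ultimately show ?case
      by (simp only: B real_sqrt_mult flip: c_def f_def s_def p_def)
  qed
  ultimately show "(\<lambda>n. (real (binomiacci n n) - 3 * 4 ^ n / sqrt (pi * real n))
      / (4 ^ n / sqrt (real n))) \<longlonglongrightarrow> 0"
    by (rule Lim_transform_eventually)
  \<comment> \<open>At \<open>n = 0\<close> the comparison function is 1 / 0 = 0, so this holds only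
    eventually.\<close>
  show "\<forall>\<^sub>F n in sequentially. 4 ^ n / sqrt (real n) \<noteq> 0"
    using eventually_gt_at_top[of 0] by eventually_elim simp
qed

end
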